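(* There is an absolute constant $c_3>0$ such that the following holds. Let $n,m\ge 1$ be integers, let $0<\eta<1$, let $0<q_-<p_-<1/e$ and $0<p_+<q_+<1/e$, and put $p_{\max}=\max\{q_+,p_-\}$. Let $E\subset\{-1,0,1\}^n$ be an increasing event which has symmetry of order $m$, and suppose that $\mathbb{P}^n_{p_-,p_+}(E)>\eta$. If $$\min\{q_+-p_+,\;p_--q_-\}\;\ge\; \frac{c_3\,\log(1/\eta)\,p_{\max}\log(1/p_{\max})}{\log m},$$ then $\mathbb{P}^n_{q_-,q_+}(E)>1-\eta$.
   Context: For $p_-,p_+>0$ with $p_-+p_+\le 1$, $\mathbb{P}^n_{p_-,p_+}$ denotes the probability measure on $\{-1,0,1\}^n$ in which the coordinates are independent and each coordinate equals $+1$ with probability $p_+$, equals $-1$ with probability $p_-$, and equals $0$ with probability $1-p_--p_+$. An event $E\subset\{-1,0,1\}^n$ is increasing if whenever $x\in E$ and $x\le x'$ holds coordinatewise (with $-1<0<1$), then $x'\in E$. The event $E$ has symmetry of order $m$ if there is a group acting on $[n]=\{1,2,\dots,n\}$ such that each orbit has size at least $m$ and the induced action on $\{-1,0,1\}^n$ (by permuting coordinates) preserves $E$. When $m=1$, so that $\log m=0$, the right-hand side of the displayed condition is read as $+\infty$, i.e. the condition is not satisfied. "Absolute constant" means independent of all parameters ($n,m,\eta,p_\pm,q_\pm,E$). *)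

theory Defs
  imports "HOL-Probability.Probability" "HOL-Algebra.Group_Action"
begin

definition cube :: "nat \<Rightarrow> (nat \<Rightarrow> int) set" where
  "cube n = {1..n} \<rightarrow>\<^sub>E {-1, 0, 1}"

text \<open>Both distributions are meaningful only for \<open>0 \<le> pm\<close>, \<open>0 \<le> pp\<close> and \<open>pm + pp \<le> 1\<close>.
  The default value \<open>undefined\<close> matches the extensional functions in \<open>cube n\<close>.\<close>

definition coord_pmf :: "real \<Rightarrow> real \<Rightarrow> int pmf" where
  "coord_pmf pm pp = pmf_of_list [(-1, pm), (0, 1 - pm - pp), (1, pp)]"

definition cube_pmf :: "nat \<Rightarrow> real \<Rightarrow> real \<Rightarrow> (nat \<Rightarrow> int) pmf" where
  "cube_pmf n pm pp = Pi_pmf {1..n} undefined (\<lambda>_. coord_pmf pm pp)"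

definition increasing_event :: "nat \<Rightarrow> (nat \<Rightarrow> int) set \<Rightarrow> bool" where
  "increasing_event n E \<longleftrightarrow> E \<subseteq> cube n \<and>
     (\<forall>x\<in>E. \<forall>x'\<in>cube n. (\<forall>i\<in>{1..n}. x i \<le> x' i) \<longrightarrow> x' \<in> E)"

text \<open>The left action \<open>(\<sigma> \<cdot> x)\<^sub>i = x\<close> at \<open>\<sigma>\<^sup>-\<^sup>1 i\<close> of a permutation
  \<open>\<sigma>\<close> of \<open>{1..n}\<close>.\<close>

definition permute_coords :: "nat \<Rightarrow> (nat \<Rightarrow> nat) \<Rightarrow> (nat \<Rightarrow> int) \<Rightarrow> (nat \<Rightarrow> int)" where
  "permute_coords n \<sigma> x = (\<lambda>i\<in>{1..n}. x (inv_into {1..n} \<sigma> i))"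

definition symmetric_via ::
  "('g, 'h) monoid_scheme \<Rightarrow> ('g \<Rightarrow> nat \<Rightarrow> nat) \<Rightarrow> nat \<Rightarrow> nat \<Rightarrow> (nat \<Rightarrow> int) set \<Rightarrow> bool" where
  "symmetric_via G \<phi> n m E \<longleftrightarrow> group_action G {1..n} \<phi> \<and>
     (\<forall>B\<in>orbits G {1..n} \<phi>. m \<le> card B) \<and>
     (\<forall>g\<in>carrier G. permute_coords n (\<phi> g) ` E = E)"

text \<open>The type of the group elements has to be fixed under the existential quantifier. The choice
  made here loses no generality, by \<open>symmetric_via_imp_has_symmetry\<close> below: any acting group can
  be replaced by its image in the group of permutations of \<open>{1..n}\<close>.\<close>

definition has_symmetry :: "nat \<Rightarrow> nat \<Rightarrow> (nat \<Rightarrow> int) set \<Rightarrow> bool" where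
  "has_symmetry n m E \<longleftrightarrow>
     (\<exists>(G :: (nat \<Rightarrow> nat) monoid) \<phi>. symmetric_via G \<phi> n m E)"

lemma symmetric_via_imp_has_symmetry:
  assumes "symmetric_via G \<phi> n m E"
  shows "has_symmetry n m E"
proof -
  let ?B = "BijGroup {1..n}"
  let ?H = "?B\<lparr>carrier := \<phi> ` carrier G\<rparr>"
  have act: "group_action G {1..n} \<phi>"
    using assms by (simp add: symmetric_via_def)
  interpret group_hom G ?B \<phi>
    using act by (rule group_action.group_hom)
  have sub: "subgroup (\<phi> ` carrier G) ?B"
    by (rule img_is_subgroup)
  have "group ?H"
    using sub by (rule group.subgroup_imp_group[OF group_BijGroup])
  moreover have "id \<in> hom ?H ?B"
    using subgroup.subset[OF sub] by (auto simp: hom_def)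
  ultimately have "group_action ?H {1..n} id"
    by (simp add: group_action_def group_hom_def group_hom_axioms_def group_BijGroup)
  moreover have "orbits ?H {1..n} id = orbits G {1..n} \<phi>"
  proof -
    have "orbit ?H id x = orbit G \<phi> x" for x
      by (auto simp: orbit_def)
    then show ?thesis
      by (simp add: orbits_def)
  qed
  ultimately have "symmetric_via ?H id n m E"
    using assms by (simp add: symmetric_via_def)
  then show ?thesis
    unfolding has_symmetry_def by blast
qed

lemma pmf_coord_pmf:
  assumes "0 \<le> pm" "0 \<le> pp" "pm + pp \<le> 1"
  shows "pmf (coord_pmf pm pp) k =
    (if k = 1 then pp else if k = -1 then pm else if k = 0 then 1 - pm - pp else 0)"
proof -
  have "pmf_of_list_wf [(-1 :: int, pm), (0, 1 - pm - pp), (1, pp)]"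
    using assms by (simp add: pmf_of_list_wf_def)
  then show ?thesis
    by (simp add: coord_pmf_def pmf_pmf_of_list)
qed

lemma pmf_cube_pmf:
  assumes "x \<in> cube n"
  shows "pmf (cube_pmf n pm pp) x = (\<Prod>i\<in>{1..n}. pmf (coord_pmf pm pp) (x i))"
  unfolding cube_pmf_def
  by (rule pmf_Pi') (use assms in \<open>auto simp: cube_def PiE_def extensional_def\<close>)

end

theory Submission
  imports Defs
begin

text \<open>
  Move the parameters linearly from \<open>(pm, pp)\<close> to \<open>(qm, qp)\<close> and let \<open>F s\<close> be the probability
  of \<open>E\<close> at time \<open>s\<close>. Every point of this path has both parameters at most \<open>p = max qp pm\<close>. By
  Russo's formula (\<open>cube_avg_has_derivative\<close>), \<open>F' \<ge> h J\<close>, where \<open>h\<close> is the smaller of the two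
  increments and the total influence \<open>J\<close> is the sum over the coordinates of the probability that
  the coordinate is pivotal. The heart of the matter is the lower bound
  \<open>F (1 - F) ln m \<le> 264 p ln (1/p) J\<close> of \<open>symmetric_total_influence_ge\<close>. With the assumed lower
  bound on \<open>h\<close> it makes the logit \<open>ln (F / (1 - F))\<close> grow at speed at least \<open>2 ln (1/\<eta>)\<close>, which
  takes \<open>F\<close> from above \<open>\<eta>\<close> to above \<open>1 - \<eta>\<close> in unit time (\<open>logistic_growth_crosses\<close>).

  The influence bound follows the entropy method of Falik and Samorodnitsky. Split \<open>f - E f\<close>, for
  \<open>f\<close> the indicator of \<open>E\<close>, into its martingale differences along the coordinates. A logarithmic
  Sobolev inequality bounds the entropy of the square of each difference by its Dirichlet energy,
  and these energies add up to at most the energy of \<open>f\<close>, which is \<open>J\<close> for an increasing event.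
  The entropy of a square is in turn large when its \<open>L\<^sup>1\<close> norm is much smaller than its \<open>L\<^sup>2\<close> norm
  (\<open>entropy_square_ge\<close>). The \<open>i\<close>-th difference has \<open>L\<^sup>1\<close> norm at most \<open>2 p\<close> times the \<open>i\<close>-th
  influence, which by symmetry is at most \<open>J / m\<close>; this is where \<open>ln m\<close> comes from.

  The energy counts squared jumps between neighbouring values, \<open>-1\<close> to \<open>0\<close> and \<open>0\<close> to \<open>1\<close>,
  without weighting them by the one-site probabilities. The one-site logarithmic Sobolev constant
  for this energy is of order \<open>p ln (1/p)\<close> even when one of the two parameters is far below \<open>p\<close>
  (\<open>three_point_log_sobolev\<close>), whereas the constant for the variance would deteriorate with the
  smallest atom.
\<close>

section \<open>Averages over the three-valued cube\<close>

text \<open>Averages are operators on functions of all integer-valued configurations: the coordinates not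
  averaged over keep the values of the argument. Expectations over \<open>n\<close> coordinates can then be
  taken one coordinate at a time, and every identity holds pointwise.\<close>

definition site_avg :: "real \<Rightarrow> real \<Rightarrow> nat \<Rightarrow> ((nat \<Rightarrow> int) \<Rightarrow> real) \<Rightarrow> (nat \<Rightarrow> int) \<Rightarrow> real" where
  "site_avg a b i f x = a * f (x(i := -1)) + (1 - a - b) * f (x(i := 0)) + b * f (x(i := 1))"

primrec cube_avg :: "real \<Rightarrow> real \<Rightarrow> nat \<Rightarrow> ((nat \<Rightarrow> int) \<Rightarrow> real) \<Rightarrow> (nat \<Rightarrow> int) \<Rightarrow> real" where
  "cube_avg a b 0 f = f"
| "cube_avg a b (Suc n) f = cube_avg a b n (site_avg a b (Suc n) f)"

text \<open>The density of the Dirichlet energy in direction \<open>i\<close>. For an increasing indicator function it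
  is the indicator of coordinate \<open>i\<close> being pivotal.\<close>

definition grad_sq :: "nat \<Rightarrow> ((nat \<Rightarrow> int) \<Rightarrow> real) \<Rightarrow> (nat \<Rightarrow> int) \<Rightarrow> real" where
  "grad_sq i f x = (f (x(i := 1)) - f (x(i := 0)))\<^sup>2 + (f (x(i := 0)) - f (x(i := -1)))\<^sup>2"

lemma grad_sq_nonneg: "0 \<le> grad_sq i f x"
  by (simp add: grad_sq_def)

lemma cube_avg_add:
  "cube_avg a b n (\<lambda>x. f x + g x) x = cube_avg a b n f x + cube_avg a b n g x"
proof (induction n arbitrary: f g)
  case (Suc n)
  have "site_avg a b (Suc n) (\<lambda>x. f x + g x)
      = (\<lambda>x. site_avg a b (Suc n) f x + site_avg a b (Suc n) g x)"
    by (simp add: fun_eq_iff site_avg_def algebra_simps)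
  then show ?case by (simp add: Suc.IH)
qed simp

lemma cube_avg_cmult: "cube_avg a b n (\<lambda>x. c * f x) x = c * cube_avg a b n f x"
proof (induction n arbitrary: f)
  case (Suc n)
  have "site_avg a b (Suc n) (\<lambda>x. c * f x) = (\<lambda>x. c * site_avg a b (Suc n) f x)"
    by (simp add: fun_eq_iff site_avg_def algebra_simps)
  then show ?case by (simp add: Suc.IH)
qed simp

lemma cube_avg_diff:
  "cube_avg a b n (\<lambda>x. f x - g x) x = cube_avg a b n f x - cube_avg a b n g x"
  using cube_avg_add[of a b n f "\<lambda>x. -1 * g x" x] cube_avg_cmult[of a b n "-1" g x] by simp

lemma cube_avg_const: "cube_avg a b n (\<lambda>x. c) x = c"
proof (induction n)
  case (Suc n)
  have "site_avg a b (Suc n) (\<lambda>x. c) = (\<lambda>x. c)"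
    by (simp add: fun_eq_iff site_avg_def algebra_simps)
  then show ?case using Suc.IH by simp
qed simp

lemma site_avg_commute:
  assumes "i \<noteq> j"
  shows "site_avg a b i (site_avg a b j f) = site_avg a b j (site_avg a b i f)"
  using assms by (simp add: fun_eq_iff site_avg_def fun_upd_twist[of i j] algebra_simps)

lemma site_avg_indep: "site_avg a b i f (x(i := v)) = site_avg a b i f x"
  by (simp add: site_avg_def)

lemma site_avg_invariant:
  assumes "\<And>x v. f (x(i := v)) = f x"
  shows "site_avg a b i f = f"
  using assms by (simp add: fun_eq_iff site_avg_def algebra_simps)

lemma cube_avg_site_avg:
  assumes "i \<in> {1..n}"
  shows "cube_avg a b n (site_avg a b i f) = cube_avg a b n f"
  using assms
proof (induction n arbitrary: f)
  case (Suc n)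
  show ?case
  proof (cases "i = Suc n")
    case True
    then show ?thesis
      by (simp add: site_avg_invariant site_avg_indep)
  next
    case False
    with Suc.prems have "i \<in> {1..n}" by auto
    with Suc.IH False show ?thesis by (simp add: site_avg_commute[of "Suc n" i])
  qed
qed simp

locale three_point =
  fixes a b :: real
  assumes a_nonneg: "0 \<le> a" and b_nonneg: "0 \<le> b" and ab_le: "a + b \<le> 1"
begin

lemma site_avg_mono:
  assumes "\<And>y. f y \<le> g y"
  shows "site_avg a b i f x \<le> site_avg a b i g x"
  unfolding site_avg_def
  using a_nonneg b_nonneg ab_le assms by (intro add_mono mult_left_mono) auto

lemma cube_avg_mono:
  assumes "\<And>y. f y \<le> g y"
  shows "cube_avg a b n f x \<le> cube_avg a b n g x"
  using assms
proof (induction n arbitrary: f g)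
  case (Suc n)
  then show ?case using site_avg_mono[OF Suc.prems] by simp
qed simp

lemma cube_avg_nonneg:
  assumes "\<And>y. 0 \<le> f y"
  shows "0 \<le> cube_avg a b n f x"
  using cube_avg_mono[of "\<lambda>_. 0" f n x] assms by (simp add: cube_avg_const)

lemma site_avg_nonneg:
  assumes "\<And>y. 0 \<le> f y"
  shows "0 \<le> site_avg a b i f x"
  using site_avg_mono[of "\<lambda>_. 0" f i x] assms by (simp add: site_avg_def)

lemma abs_site_avg_le: "\<bar>site_avg a b i f x\<bar> \<le> site_avg a b i (\<lambda>y. \<bar>f y\<bar>) x"
proof -
  have "site_avg a b i f x \<le> site_avg a b i (\<lambda>y. \<bar>f y\<bar>) x"
    by (rule site_avg_mono) simp
  moreover have "site_avg a b i (\<lambda>y. - f y) x \<le> site_avg a b i (\<lambda>y. \<bar>f y\<bar>) x"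
    by (rule site_avg_mono) simp
  moreover have "site_avg a b i (\<lambda>y. - f y) x = - site_avg a b i f x"
    by (simp add: site_avg_def)
  ultimately show ?thesis by linarith
qed

end

section \<open>The logarithmic Sobolev inequality\<close>

text \<open>The reverse triangle inequality for a weighted \<open>L\<^sup>2\<close> norm on three points.\<close>

lemma weighted_norm_diff_le:
  fixes u v w :: real
  assumes "0 \<le> u" "0 \<le> v" "0 \<le> w"
  shows "(sqrt (u * p1\<^sup>2 + v * p2\<^sup>2 + w * p3\<^sup>2) - sqrt (u * q1\<^sup>2 + v * q2\<^sup>2 + w * q3\<^sup>2))\<^sup>2
    \<le> u * (p1 - q1)\<^sup>2 + v * (p2 - q2)\<^sup>2 + w * (p3 - q3)\<^sup>2"
proof -
  let ?P = "u * p1\<^sup>2 + v * p2\<^sup>2 + w * p3\<^sup>2" and ?Q = "u * q1\<^sup>2 + v * q2\<^sup>2 + w * q3\<^sup>2"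
  let ?R = "u * p1 * q1 + v * p2 * q2 + w * p3 * q3"
  have nn: "0 \<le> ?P" "0 \<le> ?Q" using assms by auto
  have "?P * ?Q - ?R\<^sup>2 = u * v * (p1 * q2 - p2 * q1)\<^sup>2 + u * w * (p1 * q3 - p3 * q1)\<^sup>2
      + v * w * (p2 * q3 - p3 * q2)\<^sup>2"
    by algebra
  also have "0 \<le> \<dots>" using assms by auto
  finally have "?R\<^sup>2 \<le> ?P * ?Q" by simp
  then have "\<bar>?R\<bar> \<le> sqrt (?P * ?Q)"
    by (metis real_sqrt_abs real_sqrt_le_mono)
  then have "?R \<le> sqrt ?P * sqrt ?Q" by (simp add: real_sqrt_mult)
  then have "?P + ?Q - 2 * (sqrt ?P * sqrt ?Q) \<le> ?P + ?Q - 2 * ?R" by simp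
  also have "?P + ?Q - 2 * (sqrt ?P * sqrt ?Q) = (sqrt ?P - sqrt ?Q)\<^sup>2"
    using nn by (simp add: power2_diff)
  also have "?P + ?Q - 2 * ?R = u * (p1 - q1)\<^sup>2 + v * (p2 - q2)\<^sup>2 + w * (p3 - q3)\<^sup>2"
    by algebra
  finally show ?thesis .
qed

text \<open>Near \<open>s = 1\<close> the left side vanishes to second order; for large \<open>s\<close> it exceeds \<open>(s - 1)\<^sup>2\<close> only
  by a logarithmic factor, for which \<open>L\<close> is a budget.\<close>

lemma square_entropy_kernel_le:
  fixes s L :: real
  assumes "0 \<le> s" "1 \<le> L" "s > 2 \<Longrightarrow> ln s \<le> 2 * L"
  shows "s\<^sup>2 * ln (s\<^sup>2) - s\<^sup>2 + 1 \<le> 16 * L * (s - 1)\<^sup>2"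
proof (cases "s \<le> 2")
  case True
  have "s\<^sup>2 * ln (s\<^sup>2) \<le> s\<^sup>2 * (s\<^sup>2 - 1)"
    using ln_le_minus_one[of "s\<^sup>2"] by (cases "s = 0") (auto intro!: mult_left_mono)
  then have "s\<^sup>2 * ln (s\<^sup>2) - s\<^sup>2 + 1 \<le> (s - 1)\<^sup>2 * (s + 1)\<^sup>2"
    by (simp add: power2_eq_square algebra_simps)
  also have "\<dots> \<le> (s - 1)\<^sup>2 * 3\<^sup>2"
    using True assms by (intro mult_left_mono power_mono) auto
  also have "\<dots> \<le> (s - 1)\<^sup>2 * (16 * L)"
    using assms by (intro mult_left_mono) auto
  finally show ?thesis by (simp add: mult_ac)
next
  case False
  then have "s\<^sup>2 * ln (s\<^sup>2) \<le> s\<^sup>2 * (4 * L)"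
    using assms by (intro mult_left_mono) (auto simp: ln_realpow)
  moreover have "s\<^sup>2 \<le> 4 * (s - 1)\<^sup>2"
  proof -
    have "s\<^sup>2 \<le> (2 * (s - 1))\<^sup>2" using False by (intro power_mono) auto
    then show ?thesis unfolding power_mult_distrib by simp
  qed
  then have "s\<^sup>2 * (4 * L) \<le> 4 * (s - 1)\<^sup>2 * (4 * L)"
    using assms by (intro mult_right_mono) auto
  moreover have "1 \<le> s\<^sup>2" using False by (simp add: one_le_power)
  ultimately show ?thesis by (simp add: mult_ac)
qed

text \<open>The entropy of \<open>X\<close> is the minimum over \<open>t > 0\<close> of the mean of \<open>X ln (X / t) - X + t\<close>, attained at
  the mean \<open>M\<close> of \<open>X\<close>. The inequality says that every other \<open>t\<close> gives an upper bound.\<close>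

lemma entropy_variational:
  fixes M t :: real
  assumes "0 \<le> M" "0 < t"
  shows "- M * ln M \<le> - M * ln t - M + t"
proof (cases "M = 0")
  case False
  with assms have "M * ln (t / M) \<le> M * (t / M - 1)"
    by (intro mult_left_mono ln_le_minus_one) auto
  with False assms show ?thesis by (simp add: ln_div algebra_simps)
qed (use assms in simp)

lemma less_inverse_exp_one_imp_less_half:
  fixes p :: real
  assumes "p < 1 / exp 1"
  shows "p < 1 / 2"
proof -
  have "(2::real) \<le> exp 1" using exp_ge_add_one_self[of "1::real"] by simp
  then have "1 / exp 1 \<le> (1 / 2 :: real)" by (simp add: field_simps)
  with assms show ?thesis by linarith
qed

lemma one_le_ln_inverse:
  fixes p :: real
  assumes "0 < p" "p < 1 / exp 1"
  shows "1 \<le> ln (1 / p)"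
proof -
  have "exp 1 < 1 / p" using assms by (simp add: field_simps)
  then have "ln (exp 1) < ln (1 / p)" using assms by (intro ln_less_cancel_iff[THEN iffD2]) auto
  then show ?thesis by simp
qed

text \<open>In the variational bound for the entropy take \<open>t = \<tau>\<^sup>2\<close> with \<open>\<tau> = \<bar>u\<bar> + sqrt p * d\<close>, where
  \<open>d\<^sup>2\<close> is the energy. This \<open>\<tau>\<close> is close enough to \<open>\<bar>u\<bar>\<close> for the middle atom, whose weight is not
  small, to cost only \<open>4 p d\<^sup>2\<close>. It is also large enough to keep \<open>\<bar>x\<bar> / \<tau>\<close> and \<open>\<bar>y\<bar> / \<tau>\<close> below
  \<open>3 / sqrt p\<close>, so that the logarithms at the outer atoms are \<open>O(ln (1/p))\<close>, while the weights
  there are at most \<open>p\<close>.\<close>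

lemma three_point_log_sobolev:
  fixes a b p x u y :: real
  assumes a: "0 \<le> a" "a \<le> p" and b: "0 \<le> b" "b \<le> p" and ab: "a + b \<le> 1"
    and p: "0 < p" "p < 1 / exp 1"
  defines "M \<equiv> a * x\<^sup>2 + (1 - a - b) * u\<^sup>2 + b * y\<^sup>2"
  shows "a * (x\<^sup>2 * ln (x\<^sup>2)) + (1 - a - b) * (u\<^sup>2 * ln (u\<^sup>2)) + b * (y\<^sup>2 * ln (y\<^sup>2)) - M * ln M
    \<le> 132 * p * ln (1 / p) * ((y - u)\<^sup>2 + (u - x)\<^sup>2)" (is "?Ent \<le> ?rhs")
proof (cases "x = u \<and> y = u")
  case True
  then have "M = u\<^sup>2" by (simp add: M_def algebra_simps)
  with True show ?thesis by (simp add: algebra_simps)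
next
  case False
  define L where "L = ln (1 / p)"
  have L: "1 \<le> L"
    unfolding L_def using p by (rule one_le_ln_inverse)
  define d where "d = sqrt ((y - u)\<^sup>2 + (u - x)\<^sup>2)"
  define e where "e = sqrt p"
  have "p < 1" using less_inverse_exp_one_imp_less_half[OF p(2)] by simp
  then have e: "0 < e" "e \<le> 1" "e\<^sup>2 = p" using p by (auto simp: e_def)
  have d2: "d\<^sup>2 = (y - u)\<^sup>2 + (u - x)\<^sup>2" by (simp add: d_def)
  have d: "0 < d"
    unfolding d_def using False by (auto simp: sum_power2_gt_zero_iff)
  have xd: "\<bar>x - u\<bar> \<le> d" "\<bar>y - u\<bar> \<le> d"
    unfolding d_def by (auto intro!: real_le_rsqrt simp: power2_commute)
  define \<tau> where "\<tau> = \<bar>u\<bar> + e * d"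
  have \<tau>: "0 < \<tau>" using e d by (simp add: \<tau>_def add_nonneg_pos)
  define k where "k z = z\<^sup>2 * ln (z\<^sup>2) - z\<^sup>2 * ln (\<tau>\<^sup>2) - z\<^sup>2 + \<tau>\<^sup>2" for z :: real
  have k_scale: "k z = \<tau>\<^sup>2 * ((\<bar>z\<bar> / \<tau>)\<^sup>2 * ln ((\<bar>z\<bar> / \<tau>)\<^sup>2) - (\<bar>z\<bar> / \<tau>)\<^sup>2 + 1)" for z
    using \<tau> by (cases "z = 0") (simp_all add: k_def ln_div power_divide field_simps)
  have k_far: "k z \<le> 64 * L * d\<^sup>2" if z: "\<bar>z - u\<bar> \<le> d" for z
  proof -
    have "e * d \<le> d" using e d by simp
    then have zt: "\<bar>\<bar>z\<bar> - \<tau>\<bar> \<le> 2 * d" using z e d unfolding \<tau>_def by (smt (verit) mult_pos_pos)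
    have "\<bar>z\<bar> / \<tau> \<le> 1 + 2 * d / \<tau>" using zt \<tau> by (simp add: field_simps)
    also have "\<dots> \<le> 1 + 2 * d / (e * d)"
      using e d by (intro add_left_mono divide_left_mono mult_pos_pos \<tau>) (auto simp: \<tau>_def)
    also have "\<dots> \<le> 3 / e" using e d by (simp add: field_simps)
    finally have s3: "\<bar>z\<bar> / \<tau> \<le> 3 / e" .
    have "ln (\<bar>z\<bar> / \<tau>) \<le> 2 * L" if "\<bar>z\<bar> / \<tau> > 2"
    proof -
      have "ln (\<bar>z\<bar> / \<tau>) \<le> ln (3 / e)" using s3 that by (intro ln_mono) auto
      also have "\<dots> = ln 3 + L / 2"
        using e p by (simp add: ln_div L_def e_def ln_sqrt)
      also have "ln (3::real) \<le> 3 / 2"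
      proof -
        have "ln (3::real) = 2 * ln (sqrt 3)" by (simp add: ln_sqrt)
        also have "\<dots> \<le> 2 * (sqrt 3 - 1)" by (intro mult_left_mono ln_le_minus_one) auto
        also have "sqrt 3 \<le> 7 / (4::real)" by (rule real_le_lsqrt) (auto simp: power2_eq_square)
        finally show ?thesis by simp
      qed
      finally show ?thesis using L by simp
    qed
    then have "k z \<le> \<tau>\<^sup>2 * (16 * L * (\<bar>z\<bar> / \<tau> - 1)\<^sup>2)"
      unfolding k_scale using \<tau> L by (intro mult_left_mono square_entropy_kernel_le) auto
    also have "\<dots> = 16 * L * (\<bar>z\<bar> - \<tau>)\<^sup>2"
      using \<tau> by (simp add: power2_eq_square field_simps)
    also have "\<dots> \<le> 16 * L * (2 * d)\<^sup>2"
    proof (rule mult_left_mono)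
      show "(\<bar>z\<bar> - \<tau>)\<^sup>2 \<le> (2 * d)\<^sup>2"
        unfolding abs_le_square_iff[symmetric] using zt d by simp
    qed (use L in simp)
    finally show ?thesis by (simp add: power_mult_distrib)
  qed
  have k_near: "k u \<le> 4 * p * d\<^sup>2"
  proof -
    have "k u \<le> \<tau>\<^sup>2 * ((\<bar>u\<bar> / \<tau>)\<^sup>2 * ((\<bar>u\<bar> / \<tau>)\<^sup>2 - 1) - (\<bar>u\<bar> / \<tau>)\<^sup>2 + 1)"
      unfolding k_scale using \<tau> ln_le_minus_one[of "(\<bar>u\<bar> / \<tau>)\<^sup>2"]
      by (cases "u = 0") (auto intro!: mult_left_mono)
    also have "\<dots> = (\<tau> - \<bar>u\<bar>)\<^sup>2 * (1 + \<bar>u\<bar> / \<tau>)\<^sup>2"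
    proof -
      have eq: "\<bar>u\<bar> = \<tau> * (\<bar>u\<bar> / \<tau>)" using \<tau> by simp
      define r where "r = \<bar>u\<bar> / \<tau>"
      show ?thesis unfolding r_def[symmetric] using eq[folded r_def]
        by algebra
    qed
    also have "\<dots> \<le> (\<tau> - \<bar>u\<bar>)\<^sup>2 * 2\<^sup>2"
      using e d \<tau> by (intro mult_left_mono power_mono) (auto simp: \<tau>_def)
    also have "\<dots> = 4 * p * d\<^sup>2"
      using e by (simp add: \<tau>_def power_mult_distrib)
    finally show ?thesis .
  qed
  have M0: "0 \<le> M" using a b ab by (simp add: M_def)
  have "?Ent \<le> a * (x\<^sup>2 * ln (x\<^sup>2)) + (1 - a - b) * (u\<^sup>2 * ln (u\<^sup>2)) + b * (y\<^sup>2 * ln (y\<^sup>2))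
      - M * ln (\<tau>\<^sup>2) - M + \<tau>\<^sup>2"
    using entropy_variational[OF M0, of "\<tau>\<^sup>2"] \<tau> by simp
  also have "\<dots> = a * k x + (1 - a - b) * k u + b * k y"
    by (simp add: k_def M_def algebra_simps)
  also have "\<dots> \<le> p * (64 * L * d\<^sup>2) + 1 * (4 * p * d\<^sup>2) + p * (64 * L * d\<^sup>2)"
  proof (intro add_mono)
    show "a * k x \<le> p * (64 * L * d\<^sup>2)"
      by (rule order_trans[OF mult_left_mono[OF k_far[OF xd(1)] a(1)] mult_right_mono[OF a(2)]])
        (use L in simp)
    show "b * k y \<le> p * (64 * L * d\<^sup>2)"
      by (rule order_trans[OF mult_left_mono[OF k_far[OF xd(2)] b(1)] mult_right_mono[OF b(2)]])
        (use L in simp)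
    show "(1 - a - b) * k u \<le> 1 * (4 * p * d\<^sup>2)"
      by (rule order_trans[OF mult_left_mono[OF k_near] mult_right_mono]) (use ab a b p in auto)
  qed
  also have "\<dots> \<le> 132 * p * L * d\<^sup>2"
  proof -
    have "p * d\<^sup>2 * 1 \<le> p * d\<^sup>2 * L" using L p by (intro mult_left_mono) auto
    then show ?thesis by (simp add: algebra_simps)
  qed
  finally show ?thesis by (simp add: L_def d2)
qed


text \<open>Tensorisation works with any constant \<open>C\<close> in the one-site inequality.\<close>

locale three_point_lsi = three_point +
  fixes C :: real
  assumes C_nonneg: "0 \<le> C"
    and site_lsi: "a * (x\<^sup>2 * ln (x\<^sup>2)) + (1 - a - b) * (u\<^sup>2 * ln (u\<^sup>2)) + b * (y\<^sup>2 * ln (y\<^sup>2))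
      - (a * x\<^sup>2 + (1 - a - b) * u\<^sup>2 + b * y\<^sup>2) * ln (a * x\<^sup>2 + (1 - a - b) * u\<^sup>2 + b * y\<^sup>2)
      \<le> C * ((y - u)\<^sup>2 + (u - x)\<^sup>2)"

lemma site_avg_grad_sq_same: "site_avg a b i (grad_sq i f) = grad_sq i f"
  by (rule site_avg_invariant) (simp add: grad_sq_def)

text \<open>The \<open>L\<^sup>2\<close> norm over site \<open>j\<close> is 1-Lipschitz, so averaging a square over one site and taking the
  root does not increase the energy in the other directions.\<close>

lemma (in three_point) grad_sq_sqrt_site_avg_le:
  assumes "i \<noteq> j"
  shows "grad_sq i (\<lambda>y. sqrt (site_avg a b j (\<lambda>z. (g z)\<^sup>2) y)) x \<le> site_avg a b j (grad_sq i g) x"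
proof -
  have w: "0 \<le> a" "0 \<le> 1 - a - b" "0 \<le> b" using a_nonneg b_nonneg ab_le by auto
  let ?g = "\<lambda>v w. g (x(i := v, j := w))"
  have "grad_sq i (\<lambda>y. sqrt (site_avg a b j (\<lambda>z. (g z)\<^sup>2) y)) x
     = (sqrt (a * (?g 1 (-1))\<^sup>2 + (1 - a - b) * (?g 1 0)\<^sup>2 + b * (?g 1 1)\<^sup>2)
        - sqrt (a * (?g 0 (-1))\<^sup>2 + (1 - a - b) * (?g 0 0)\<^sup>2 + b * (?g 0 1)\<^sup>2))\<^sup>2
     + (sqrt (a * (?g 0 (-1))\<^sup>2 + (1 - a - b) * (?g 0 0)\<^sup>2 + b * (?g 0 1)\<^sup>2)
        - sqrt (a * (?g (-1) (-1))\<^sup>2 + (1 - a - b) * (?g (-1) 0)\<^sup>2 + b * (?g (-1) 1)\<^sup>2))\<^sup>2"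
    by (simp add: grad_sq_def site_avg_def)
  also have "\<dots> \<le> (a * (?g 1 (-1) - ?g 0 (-1))\<^sup>2 + (1 - a - b) * (?g 1 0 - ?g 0 0)\<^sup>2
        + b * (?g 1 1 - ?g 0 1)\<^sup>2)
     + (a * (?g 0 (-1) - ?g (-1) (-1))\<^sup>2 + (1 - a - b) * (?g 0 0 - ?g (-1) 0)\<^sup>2
        + b * (?g 0 1 - ?g (-1) 1)\<^sup>2)"
    by (intro add_mono weighted_norm_diff_le w)
  also have "\<dots> = site_avg a b j (grad_sq i g) x"
    using assms by (simp add: grad_sq_def site_avg_def fun_upd_twist[of i j] algebra_simps)
  finally show ?thesis .
qed

text \<open>The entropy of \<open>g\<^sup>2\<close> is the mean entropy over the last site plus the entropy of \<open>h\<^sup>2\<close>, where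
  \<open>h\<close> is the \<open>L\<^sup>2\<close> norm of \<open>g\<close> over that site. The one-site inequality controls the first part and
  the induction hypothesis the second, because \<open>h\<close> has no more energy than \<open>g\<close>.\<close>

lemma (in three_point_lsi) cube_log_sobolev:
  "cube_avg a b n (\<lambda>y. (g y)\<^sup>2 * ln ((g y)\<^sup>2)) x
     - cube_avg a b n (\<lambda>y. (g y)\<^sup>2) x * ln (cube_avg a b n (\<lambda>y. (g y)\<^sup>2) x)
   \<le> C * (\<Sum>i = 1..n. cube_avg a b n (grad_sq i g) x)"
proof (induction n arbitrary: g)
  case (Suc n)
  let ?A = "site_avg a b (Suc n)" and ?E = "\<lambda>f. cube_avg a b n f x"
  define h where "h y = sqrt (?A (\<lambda>z. (g z)\<^sup>2) y)" for y
  have h2: "(h y)\<^sup>2 = ?A (\<lambda>z. (g z)\<^sup>2) y" for y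
    unfolding h_def by (simp add: site_avg_nonneg)
  have "?E (?A (\<lambda>y. (g y)\<^sup>2 * ln ((g y)\<^sup>2))) - ?E (\<lambda>y. (h y)\<^sup>2 * ln ((h y)\<^sup>2))
      = ?E (\<lambda>y. ?A (\<lambda>y. (g y)\<^sup>2 * ln ((g y)\<^sup>2)) y - (h y)\<^sup>2 * ln ((h y)\<^sup>2))"
    by (simp add: cube_avg_diff)
  also have "\<dots> \<le> ?E (\<lambda>y. C * grad_sq (Suc n) g y)"
    by (rule cube_avg_mono, unfold h2) (use site_lsi in \<open>simp add: site_avg_def grad_sq_def\<close>)
  also have "\<dots> = C * cube_avg a b (Suc n) (grad_sq (Suc n) g) x"
    by (simp add: cube_avg_cmult site_avg_grad_sq_same)
  finally have new: "?E (?A (\<lambda>y. (g y)\<^sup>2 * ln ((g y)\<^sup>2))) - ?E (\<lambda>y. (h y)\<^sup>2 * ln ((h y)\<^sup>2))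
      \<le> C * cube_avg a b (Suc n) (grad_sq (Suc n) g) x" .
  have "C * (\<Sum>i = 1..n. ?E (grad_sq i h)) \<le> C * (\<Sum>i = 1..n. cube_avg a b (Suc n) (grad_sq i g) x)"
    unfolding h_def cube_avg.simps
    by (intro mult_left_mono sum_mono cube_avg_mono grad_sq_sqrt_site_avg_le C_nonneg) auto
  with Suc.IH[of h] have old: "?E (\<lambda>y. (h y)\<^sup>2 * ln ((h y)\<^sup>2)) - ?E (\<lambda>y. (h y)\<^sup>2) * ln (?E (\<lambda>y. (h y)\<^sup>2))
      \<le> C * (\<Sum>i = 1..n. cube_avg a b (Suc n) (grad_sq i g) x)"
    by linarith
  have "?E (\<lambda>y. (h y)\<^sup>2) = cube_avg a b (Suc n) (\<lambda>y. (g y)\<^sup>2) x"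
    by (simp add: h2[abs_def])
  with new old show ?case by (simp add: distrib_left)
qed simp

section \<open>The inequality of Falik and Samorodnitsky\<close>

text \<open>A linearised form of \<open>Ent (g\<^sup>2) \<ge> v ln (v / w\<^sup>2)\<close>, where \<open>v\<close> is the mean of \<open>g\<^sup>2\<close> and \<open>w\<close> the mean
  of \<open>\<bar>g\<bar>\<close>. Being linear in \<open>v\<close> and \<open>w\<^sup>2\<close>, it can be summed over the martingale differences with one
  and the same \<open>K\<close>. It comes from averaging the consequence
  \<open>z\<^sup>2 ln (z\<^sup>2) \<ge> 2 ((ln c + 1) z\<^sup>2 - c \<bar>z\<bar>)\<close> of \<open>ln t \<le> t - 1\<close>.\<close>

lemma (in three_point) entropy_square_ge:
  fixes g x n
  assumes K: "0 < K"
  defines "v \<equiv> cube_avg a b n (\<lambda>y. (g y)\<^sup>2) x"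
  shows "v * (ln K + 1) - K * (cube_avg a b n (\<lambda>y. \<bar>g y\<bar>) x)\<^sup>2
    \<le> cube_avg a b n (\<lambda>y. (g y)\<^sup>2 * ln ((g y)\<^sup>2)) x - v * ln v"
proof -
  define w where "w = cube_avg a b n (\<lambda>y. \<bar>g y\<bar>) x"
  have v: "0 \<le> v" unfolding v_def by (rule cube_avg_nonneg) simp
  have w: "0 \<le> w" unfolding w_def by (rule cube_avg_nonneg) simp
  have pt: "2 * ((ln c + 1) * z\<^sup>2 - c * \<bar>z\<bar>) \<le> z\<^sup>2 * ln (z\<^sup>2)" if c: "0 < c" for c z :: real
  proof (cases "z = 0")
    case False
    have "ln (c / \<bar>z\<bar>) \<le> c / \<bar>z\<bar> - 1" using c False by (intro ln_le_minus_one) auto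
    then have "z\<^sup>2 * (ln c + 1 - c / \<bar>z\<bar>) \<le> z\<^sup>2 * ln \<bar>z\<bar>"
      using c False by (intro mult_left_mono) (auto simp: ln_div)
    moreover have "z\<^sup>2 * (c / \<bar>z\<bar>) = c * \<bar>z\<bar>"
      using False by (simp add: power2_eq_square field_simps abs_mult_self_eq)
    moreover have "ln (z\<^sup>2) = 2 * ln \<bar>z\<bar>"
      using False ln_realpow[of "\<bar>z\<bar>" 2] by simp
    ultimately show ?thesis by (simp add: algebra_simps)
  qed simp
  have lower: "2 * ((ln c + 1) * v - c * w) \<le> cube_avg a b n (\<lambda>y. (g y)\<^sup>2 * ln ((g y)\<^sup>2)) x"
    if c: "0 < c" for c
  proof -
    have "2 * ((ln c + 1) * v - c * w)
        = cube_avg a b n (\<lambda>y. 2 * ((ln c + 1) * (g y)\<^sup>2 - c * \<bar>g y\<bar>)) x"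
      by (simp add: v_def w_def cube_avg_cmult cube_avg_diff)
    also have "\<dots> \<le> cube_avg a b n (\<lambda>y. (g y)\<^sup>2 * ln ((g y)\<^sup>2)) x"
      by (rule cube_avg_mono) (rule pt[OF c])
    finally show ?thesis .
  qed
  show ?thesis
  proof (cases "v = 0")
    case True
    have "- K * w\<^sup>2 \<le> cube_avg a b n (\<lambda>y. (g y)\<^sup>2 * ln ((g y)\<^sup>2)) x"
    proof (cases "w = 0")
      case True
      then show ?thesis using lower[of 1] \<open>v = 0\<close> by simp
    next
      case False
      then show ?thesis using lower[of "K * w / 2"] \<open>v = 0\<close> K w by (simp add: power2_eq_square)
    qed
    with True show ?thesis by (simp add: w_def)
  next
    case False
    with v have v: "0 < v" by simp
    \<comment> \<open>The choice \<open>c = sqrt (K v)\<close> lets the cross term be split by the inequality of arithmetic and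
      geometric means.\<close>
    have "0 \<le> (sqrt v - sqrt K * w)\<^sup>2" by simp
    also have "\<dots> = v + K * w\<^sup>2 - 2 * (sqrt (K * v) * w)"
      using v K by (simp add: power2_diff power_mult_distrib real_sqrt_mult)
    finally have "2 * (sqrt (K * v) * w) \<le> v + K * w\<^sup>2" by simp
    moreover have "2 * (ln (sqrt (K * v)) * v) = v * ln K + v * ln v"
      using v K by (simp add: ln_sqrt ln_mult algebra_simps)
    ultimately show ?thesis
      using lower[of "sqrt (K * v)"] v K by (simp add: w_def[symmetric] algebra_simps)
  qed
qed

lemma three_point_pythagoras:
  fixes a b p q r m :: real
  assumes "m = a * p + (1 - a - b) * q + b * r"
  shows "a * p\<^sup>2 + (1 - a - b) * q\<^sup>2 + b * r\<^sup>2
    = a * (p - m)\<^sup>2 + (1 - a - b) * (q - m)\<^sup>2 + b * (r - m)\<^sup>2 + m\<^sup>2"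
  unfolding assms by algebra

lemma site_avg_square:
  "site_avg a b i (\<lambda>y. (f y)\<^sup>2) y
    = site_avg a b i (\<lambda>y. (f y - site_avg a b i f y)\<^sup>2) y + (site_avg a b i f y)\<^sup>2"
  using three_point_pythagoras[of "site_avg a b i f y" a "f (y(i := -1))" b "f (y(i := 0))" "f (y(i := 1))"]
  by (simp add: site_avg_def)

text \<open>Differences in direction \<open>i\<close> commute with the average over another site \<open>j\<close>, so the energy
  splits orthogonally between \<open>f\<close> averaged over \<open>j\<close> and the centred rest.\<close>

lemma site_avg_grad_sq:
  assumes "i \<noteq> j"
  shows "site_avg a b j (grad_sq i f) y
    = site_avg a b j (grad_sq i (\<lambda>y. f y - site_avg a b j f y)) y + grad_sq i (site_avg a b j f) y"
proof -
  define D where "D v w z = f (z(i := v)) - f (z(i := w))" for v w z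
  have avg_D: "site_avg a b j (D v w) z
      = site_avg a b j f (z(i := v)) - site_avg a b j f (z(i := w))" for v w z
    using assms by (simp add: D_def site_avg_def fun_upd_twist[of i j] algebra_simps)
  have grad_f: "grad_sq i f = (\<lambda>z. (D 1 0 z)\<^sup>2 + (D 0 (-1) z)\<^sup>2)"
    by (simp add: fun_eq_iff grad_sq_def D_def)
  have grad_diff: "grad_sq i (\<lambda>y. f y - site_avg a b j f y)
      = (\<lambda>z. (D 1 0 z - site_avg a b j (D 1 0) z)\<^sup>2 + (D 0 (-1) z - site_avg a b j (D 0 (-1)) z)\<^sup>2)"
    by (simp add: fun_eq_iff grad_sq_def avg_D D_def algebra_simps)
  have grad_avg: "grad_sq i (site_avg a b j f) y
      = (site_avg a b j (D 1 0) y)\<^sup>2 + (site_avg a b j (D 0 (-1)) y)\<^sup>2"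
    by (simp add: grad_sq_def avg_D)
  have add: "site_avg a b j (\<lambda>z. g z + h z) y = site_avg a b j g y + site_avg a b j h y" for g h
    by (simp add: site_avg_def algebra_simps)
  show ?thesis
    unfolding grad_f grad_diff grad_avg add
    using site_avg_square[of a b j "D 1 0" y] site_avg_square[of a b j "D 0 (-1)" y] by simp
qed

text \<open>Averaging over the last site contracts the \<open>L\<^sup>1\<close> norms that occur in the next theorem.\<close>

lemma (in three_point) cube_avg_abs_centred_site_avg_le:
  assumes "i \<noteq> Suc n"
  shows "cube_avg a b n (\<lambda>y. \<bar>site_avg a b (Suc n) f y - site_avg a b i (site_avg a b (Suc n) f) y\<bar>) x
    \<le> cube_avg a b (Suc n) (\<lambda>y. \<bar>f y - site_avg a b i f y\<bar>) x"
proof -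
  let ?A = "site_avg a b (Suc n)"
  have "?A f y - site_avg a b i (?A f) y = ?A (\<lambda>z. f z - site_avg a b i f z) y" for y
    unfolding site_avg_commute[OF assms] by (simp add: site_avg_def algebra_simps)
  then show ?thesis
    by (simp add: cube_avg_mono abs_site_avg_le)
qed

text \<open>Induction on \<open>n\<close>, peeling off the martingale difference \<open>d = f - g\<close>, where \<open>g\<close> is the average of
  \<open>f\<close> over the last site. The variance and the energy of \<open>f\<close> are the sums of those of \<open>g\<close> and \<open>d\<close>;
  to \<open>g\<close> the induction hypothesis applies, and to \<open>d\<close> the logarithmic Sobolev inequality together
  with the entropy bound. In the term with \<open>K\<close>, the \<open>L\<^sup>1\<close> norms of the martingale differences have
  been replaced by the larger norms of \<open>f - site_avg a b i f\<close>, which do not refer to the order of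
  the coordinates.\<close>

theorem (in three_point_lsi) falik_samorodnitsky:
  assumes K: "0 < K"
  shows "(cube_avg a b n (\<lambda>y. (f y)\<^sup>2) x - (cube_avg a b n f x)\<^sup>2) * (ln K + 1)
     - K * (\<Sum>i = 1..n. (cube_avg a b n (\<lambda>y. \<bar>f y - site_avg a b i f y\<bar>) x)\<^sup>2)
   \<le> C * (\<Sum>i = 1..n. cube_avg a b n (grad_sq i f) x)"
proof (induction n arbitrary: f)
  case (Suc n)
  let ?N = "Suc n"
  let ?E = "\<lambda>f. cube_avg a b n f x" and ?E' = "\<lambda>f. cube_avg a b (Suc n) f x"
  define g where "g = site_avg a b ?N f"
  define d where "d y = f y - g y" for y
  have d_eq: "d = (\<lambda>y. f y - site_avg a b ?N f y)"
    by (simp add: fun_eq_iff d_def g_def)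
  have "site_avg a b ?N (\<lambda>y. (f y)\<^sup>2) = (\<lambda>y. site_avg a b ?N (\<lambda>y. (d y)\<^sup>2) y + (g y)\<^sup>2)"
    unfolding d_eq g_def by (rule ext) (rule site_avg_square)
  then have var: "?E' (\<lambda>y. (f y)\<^sup>2) = ?E' (\<lambda>y. (d y)\<^sup>2) + ?E (\<lambda>y. (g y)\<^sup>2)"
    by (simp add: cube_avg_add)
  have grad: "?E' (grad_sq i d) + ?E (grad_sq i g) = ?E' (grad_sq i f)" if "i \<noteq> ?N" for i
  proof -
    have "site_avg a b ?N (grad_sq i f) = (\<lambda>y. site_avg a b ?N (grad_sq i d) y + grad_sq i g y)"
      unfolding d_eq g_def by (rule ext) (rule site_avg_grad_sq[OF that])
    then show ?thesis by (simp add: cube_avg_add)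
  qed
  have grad_N: "grad_sq ?N d = grad_sq ?N f"
    by (simp add: fun_eq_iff grad_sq_def d_def g_def site_avg_indep)
  have L1: "K * (\<Sum>i = 1..n. (?E (\<lambda>y. \<bar>g y - site_avg a b i g y\<bar>))\<^sup>2)
      \<le> K * (\<Sum>i = 1..n. (?E' (\<lambda>y. \<bar>f y - site_avg a b i f y\<bar>))\<^sup>2)"
    unfolding g_def using K
    by (intro mult_left_mono sum_mono power_mono cube_avg_abs_centred_site_avg_le cube_avg_nonneg) auto
  have "?E' (\<lambda>y. (d y)\<^sup>2) * (ln K + 1) - K * (?E' (\<lambda>y. \<bar>d y\<bar>))\<^sup>2
      \<le> C * (\<Sum>i = 1..?N. ?E' (grad_sq i d))"
    using entropy_square_ge[OF K, of ?N d x] cube_log_sobolev[of ?N d x] by linarith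
  moreover note Suc.IH[of g]
  moreover have "(\<Sum>i = 1..?N. ?E' (grad_sq i d)) + (\<Sum>i = 1..n. ?E (grad_sq i g))
      = (\<Sum>i = 1..?N. ?E' (grad_sq i f))"
  proof -
    have "(\<Sum>i = 1..n. ?E' (grad_sq i d)) + (\<Sum>i = 1..n. ?E (grad_sq i g))
        = (\<Sum>i = 1..n. ?E' (grad_sq i f))"
      unfolding sum.distrib[symmetric] by (rule sum.cong[OF refl], rule grad) auto
    then show ?thesis by (simp add: grad_N)
  qed
  then have "C * (\<Sum>i = 1..?N. ?E' (grad_sq i d)) + C * (\<Sum>i = 1..n. ?E (grad_sq i g))
      = C * (\<Sum>i = 1..?N. ?E' (grad_sq i f))"
    by (simp add: distrib_left[symmetric])
  moreover have "?E' f = ?E g" by (simp add: g_def)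
  then have "(?E' (\<lambda>y. (f y)\<^sup>2) - (?E' f)\<^sup>2) * (ln K + 1)
      = ?E' (\<lambda>y. (d y)\<^sup>2) * (ln K + 1) + (?E (\<lambda>y. (g y)\<^sup>2) - (?E g)\<^sup>2) * (ln K + 1)"
    unfolding var by (simp only: distrib_right[symmetric] add_diff_eq)
  moreover have "K * (\<Sum>i = 1..?N. (?E' (\<lambda>y. \<bar>f y - site_avg a b i f y\<bar>))\<^sup>2)
      = K * (\<Sum>i = 1..n. (?E' (\<lambda>y. \<bar>f y - site_avg a b i f y\<bar>))\<^sup>2) + K * (?E' (\<lambda>y. \<bar>d y\<bar>))\<^sup>2"
    by (simp add: d_def g_def distrib_left)
  ultimately show ?case using L1 by linarith
qed simp

text \<open>Where \<open>i\<close> is not pivotal, \<open>f\<close> does not depend on coordinate \<open>i\<close> and both sides vanish. Where it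
  is, \<open>f\<close> is a Bernoulli variable in coordinate \<open>i\<close> which is 1 with probability \<open>b\<close> or 0 with
  probability \<open>a\<close>, and its mean absolute deviation is \<open>2 b (1 - b)\<close> or \<open>2 a (1 - a)\<close>.\<close>

lemma (in three_point) cube_avg_abs_centred_le_grad_sq:
  assumes i: "i \<in> {1..n}" and p: "a \<le> p" "b \<le> p"
    and f01: "\<And>y. f y \<in> {0, 1}"
    and mono: "\<And>y. f (y(i := -1)) \<le> f (y(i := 0))" "\<And>y. f (y(i := 0)) \<le> f (y(i := 1))"
  shows "cube_avg a b n (\<lambda>y. \<bar>f y - site_avg a b i f y\<bar>) x \<le> 2 * p * cube_avg a b n (grad_sq i f) x"
proof -
  have pt: "site_avg a b i (\<lambda>y. \<bar>f y - site_avg a b i f y\<bar>) y \<le> 2 * p * grad_sq i f y" for y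
  proof -
    have aux: "2 * t * (1 - t) \<le> 2 * p" if "0 \<le> t" "t \<le> p" for t :: real
    proof -
      have "t * (1 - t) \<le> t" using that by (simp add: algebra_simps)
      with that show ?thesis by simp
    qed
    have vals: "f (y(i := v)) = 0 \<or> f (y(i := v)) = 1" for v using f01 by auto
    have bounds: "\<bar>1 - a\<bar> = 1 - a" "\<bar>1 - b\<bar> = 1 - b" "\<bar>a - 1\<bar> = 1 - a" "\<bar>b - 1\<bar> = 1 - b"
      "\<bar>a\<bar> = a" "\<bar>b\<bar> = b"
      using a_nonneg b_nonneg ab_le by auto
    show ?thesis
      using vals[of "-1"] vals[of 0] vals[of 1] mono[of y] aux[of a] aux[of b] a_nonneg b_nonneg p
      by (auto simp: site_avg_def grad_sq_def bounds algebra_simps)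
  qed
  have "cube_avg a b n (\<lambda>y. \<bar>f y - site_avg a b i f y\<bar>) x
      = cube_avg a b n (site_avg a b i (\<lambda>y. \<bar>f y - site_avg a b i f y\<bar>)) x"
    by (simp add: cube_avg_site_avg[OF i])
  also have "\<dots> \<le> cube_avg a b n (\<lambda>y. 2 * p * grad_sq i f y) x"
    by (rule cube_avg_mono) (rule pt)
  finally show ?thesis by (simp add: cube_avg_cmult)
qed


section \<open>Russo's formula\<close>

definition site_slope :: "real \<Rightarrow> real \<Rightarrow> nat \<Rightarrow> ((nat \<Rightarrow> int) \<Rightarrow> real) \<Rightarrow> (nat \<Rightarrow> int) \<Rightarrow> real" where
  "site_slope a' b' i f x = a' * (f (x(i := -1)) - f (x(i := 0))) + b' * (f (x(i := 1)) - f (x(i := 0)))"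

text \<open>The averaged function may itself depend on the parameter \<open>s\<close>: this makes the induction work, since
  averaging over the last site turns a fixed function into one that depends on the weights.\<close>

theorem cube_avg_has_derivative:
  assumes \<alpha>: "(\<alpha> has_real_derivative a') (at t)" and \<beta>: "(\<beta> has_real_derivative b') (at t)"
    and F: "\<And>y. ((\<lambda>s. F s y) has_real_derivative F' y) (at t)"
  shows "((\<lambda>s. cube_avg (\<alpha> s) (\<beta> s) n (F s) x) has_real_derivative
      cube_avg (\<alpha> t) (\<beta> t) n F' x
      + (\<Sum>i = 1..n. cube_avg (\<alpha> t) (\<beta> t) n (site_slope a' b' i (F t)) x)) (at t)"
  using F
proof (induction n arbitrary: F F')
  case (Suc n)
  let ?A = "site_avg (\<alpha> t) (\<beta> t) (Suc n)" and ?S = "site_slope a' b'"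
  have step: "((\<lambda>s. site_avg (\<alpha> s) (\<beta> s) (Suc n) (F s) y) has_real_derivative
      ?A F' y + ?S (Suc n) (F t) y) (at t)" for y
    unfolding site_avg_def
    by (rule derivative_eq_intros \<alpha> \<beta> Suc.prems refl)+ (simp add: site_slope_def fun_upd_def algebra_simps)
  have same: "?A (?S (Suc n) (F t)) = ?S (Suc n) (F t)"
    by (rule site_avg_invariant) (simp add: site_slope_def)
  have other: "?S i (?A (F t)) = ?A (?S i (F t))" if "i \<noteq> Suc n" for i
    using that by (simp add: fun_eq_iff site_slope_def site_avg_def fun_upd_twist[of i "Suc n"] algebra_simps)
  have sum: "(\<Sum>i = 1..n. cube_avg (\<alpha> t) (\<beta> t) n (?S i (?A (F t))) x)
      = (\<Sum>i = 1..n. cube_avg (\<alpha> t) (\<beta> t) n (?A (?S i (F t))) x)"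
    by (rule sum.cong[OF refl], subst other) auto
  show ?case
    using Suc.IH[of "\<lambda>s. site_avg (\<alpha> s) (\<beta> s) (Suc n) (F s)", OF step]
    by (simp add: sum same cube_avg_add algebra_simps del: One_nat_def)
qed simp

section \<open>Symmetric increasing events\<close>

lemma set_coord_pmf:
  assumes "0 \<le> a" "0 \<le> b" "a + b \<le> 1"
  shows "set_pmf (coord_pmf a b) \<subseteq> {-1, 0, 1}"
  using assms by (auto simp: set_pmf_iff pmf_coord_pmf split: if_splits)

lemma finite_set_cube_pmf:
  fixes n :: nat
  assumes "0 \<le> a" "0 \<le> b" "a + b \<le> 1"
  shows "finite (set_pmf (Pi_pmf {1..n} undefined (\<lambda>_. coord_pmf a b)))"
  using finite_subset[OF set_coord_pmf[OF assms]]
  by (intro finite_subset[OF set_Pi_pmf_subset'] finite_PiE_dflt) auto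

lemma cube_avg_eq_expectation:
  assumes ab: "0 \<le> a" "0 \<le> b" "a + b \<le> 1"
  shows "cube_avg a b n f (\<lambda>_. undefined) = measure_pmf.expectation (cube_pmf n a b) f"
proof (induction n arbitrary: f)
  case 0
  then show ?case by (simp add: cube_pmf_def)
next
  case (Suc n)
  let ?P = "Pi_pmf {1..n} undefined (\<lambda>_. coord_pmf a b)"
  have IH: "cube_avg a b n h (\<lambda>_. undefined) = measure_pmf.expectation ?P h" for h
    using Suc.IH[of h] by (simp add: cube_pmf_def)
  have "{1..Suc n} = insert (Suc n) {1..n}" by auto
  then have "cube_pmf (Suc n) a b = coord_pmf a b \<bind> (\<lambda>v. map_pmf (\<lambda>g. g(Suc n := v)) ?P)"
    by (simp add: cube_pmf_def Pi_pmf_insert' map_pmf_def)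
  then have "measure_pmf.expectation (cube_pmf (Suc n) a b) f
      = (\<Sum>v\<in>{-1, 0, 1}. pmf (coord_pmf a b) v * measure_pmf.expectation ?P (\<lambda>g. f (g(Suc n := v))))"
    using finite_set_cube_pmf[OF ab, of n] set_coord_pmf[OF ab]
    by (simp only:, subst pmf_expectation_bind[where A = "{-1, 0, 1}"]) auto
  also have "\<dots> = cube_avg a b (Suc n) f (\<lambda>_. undefined)"
    by (simp add: pmf_coord_pmf[OF ab] IH site_avg_def[abs_def] cube_avg_add cube_avg_cmult
        del: One_nat_def)
  finally show ?case by simp
qed

text \<open>The indicator of \<open>E\<close>, extended from the cube to all integer configurations by clamping the
  values with \<open>sgn\<close>. The extension inherits monotonicity and the symmetries of \<open>E\<close> on the
  whole space, so inequalities between averages can be checked at every configuration.\<close>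

definition cube_ext :: "nat \<Rightarrow> (nat \<Rightarrow> int) set \<Rightarrow> (nat \<Rightarrow> int) \<Rightarrow> real" where
  "cube_ext n E y = indicator E (\<lambda>i\<in>{1..n}. sgn (y i))"

lemma restrict_sgn_in_cube: "(\<lambda>i\<in>{1..n}. sgn (y i)) \<in> cube n"
  by (auto simp: cube_def sgn_if)

lemma cube_ext_on_cube:
  assumes "y \<in> cube n"
  shows "cube_ext n E y = indicator E y"
proof -
  have "(\<lambda>i\<in>{1..n}. sgn (y i)) = y"
    using assms by (auto simp: cube_def fun_eq_iff PiE_def extensional_def sgn_if Pi_def)
  then show ?thesis by (simp add: cube_ext_def)
qed

lemma cube_ext_01: "cube_ext n E y \<in> {0, 1}"
  by (simp add: cube_ext_def indicator_def)

lemma cube_ext_mono: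
  assumes "increasing_event n E" "\<And>i. y i \<le> z i"
  shows "cube_ext n E y \<le> cube_ext n E z"
proof -
  have "(\<lambda>i\<in>{1..n}. sgn (z i)) \<in> E" if "(\<lambda>i\<in>{1..n}. sgn (y i)) \<in> E"
  proof -
    have "sgn (y i) \<le> sgn (z i)" for i using assms(2)[of i] by (auto simp: sgn_if)
    then show ?thesis
      using assms(1) that restrict_sgn_in_cube[where n = n and y = z]
      unfolding increasing_event_def by simp
  qed
  then show ?thesis by (simp add: cube_ext_def indicator_def)
qed

text \<open>The permuted configuration \<open>y \<circ> \<sigma>\<close> is the inverse image of \<open>y\<close> under the action of \<open>\<sigma>\<close>.
  Since the action is injective on the cube and maps \<open>E\<close> onto itself, it also reflects membership
  in \<open>E\<close>.\<close>

lemma cube_ext_permute: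
  assumes E: "E \<subseteq> cube n" and \<sigma>: "bij_betw \<sigma> {1..n} {1..n}"
    and sym: "permute_coords n \<sigma> ` E = E"
  shows "cube_ext n E (\<lambda>i. y (\<sigma> i)) = cube_ext n E y"
proof -
  let ?w = "\<lambda>i\<in>{1..n}. sgn (y (\<sigma> i))" and ?x = "\<lambda>i\<in>{1..n}. sgn (y i)"
  have inv: "inv_into {1..n} \<sigma> i \<in> {1..n}" "\<sigma> (inv_into {1..n} \<sigma> i) = i" if "i \<in> {1..n}" for i
    using that \<sigma> by (auto simp: bij_betw_def intro!: inv_into_into[of i \<sigma> "{1..n}", simplified] f_inv_into_f)
  have perm: "permute_coords n \<sigma> ?w = ?x"
    using inv by (auto simp: permute_coords_def fun_eq_iff)
  have "?w \<in> E \<longleftrightarrow> ?x \<in> E"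
  proof
    assume "?w \<in> E"
    then show "?x \<in> E" using sym perm by (metis imageI)
  next
    assume "?x \<in> E"
    then obtain w where w: "w \<in> E" "permute_coords n \<sigma> w = ?x" using sym by (metis imageE)
    have "w i = ?w i" for i
    proof (cases "i \<in> {1..n}")
      case True
      then have si: "\<sigma> i \<in> {1..n}" using \<sigma> by (auto simp: bij_betw_def)
      have "inv_into {1..n} \<sigma> (\<sigma> i) = i" using True \<sigma> by (simp add: bij_betw_def)
      with fun_cong[OF w(2), of "\<sigma> i"] si True show ?thesis by (simp add: permute_coords_def)
    next
      case False
      then show ?thesis using w(1) E by (auto simp: cube_def PiE_def extensional_def)
    qed
    then have "w = ?w" by blast
    with w(1) show "?w \<in> E" by simp
  qed
  then show ?thesis by (simp add: cube_ext_def indicator_def)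
qed

lemma grad_sq_permute_average:
  assumes ab: "0 \<le> a" "0 \<le> b" "a + b \<le> 1"
    and E: "E \<subseteq> cube n" and \<sigma>: "bij_betw \<sigma> {1..n} {1..n}"
    and sym: "permute_coords n \<sigma> ` E = E" and i: "i \<in> {1..n}"
  shows "cube_avg a b n (grad_sq (\<sigma> i) (cube_ext n E)) (\<lambda>_. undefined)
    = cube_avg a b n (grad_sq i (cube_ext n E)) (\<lambda>_. undefined)"
proof -
  \<comment> \<open>\<open>\<sigma>\<close> is unspecified outside \<open>{1..n}\<close>; there the identity preserves the default value of the
    product measure.\<close>
  define h where "h j = (if j \<in> {1..n} then \<sigma> j else j)" for j
  have h: "bij_betw h {1..n} {1..n}"
    using \<sigma> by (subst bij_betw_cong[of _ _ \<sigma>]) (auto simp: h_def)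
  have inj_h: "h j = h k \<longleftrightarrow> j = k" for j k
    using \<sigma> unfolding bij_betw_def inj_on_def h_def by (smt (verit) imageI)
  have ext: "cube_ext n E (z \<circ> h) = cube_ext n E z" for z
  proof -
    have "cube_ext n E (z \<circ> h) = cube_ext n E (\<lambda>i. z (\<sigma> i))"
      by (simp add: cube_ext_def h_def cong: restrict_cong)
    then show ?thesis using cube_ext_permute[OF E \<sigma> sym] by simp
  qed
  have upd: "(y \<circ> h)(i := v) = y(\<sigma> i := v) \<circ> h" for y :: "nat \<Rightarrow> int" and v
    using inj_h[of _ i] i by (auto simp: fun_eq_iff h_def)
  have "cube_pmf n a b = map_pmf (\<lambda>g. g \<circ> h) (cube_pmf n a b)"
    unfolding cube_pmf_def by (rule Pi_pmf_bij_betw) (use h in \<open>auto simp: h_def\<close>)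
  from arg_cong[OF this, of "\<lambda>q. measure_pmf.expectation q (grad_sq i (cube_ext n E))"]
  have "measure_pmf.expectation (cube_pmf n a b) (grad_sq i (cube_ext n E))
      = measure_pmf.expectation (cube_pmf n a b) (\<lambda>y. grad_sq i (cube_ext n E) (y \<circ> h))"
    by (simp only: integral_map_pmf)
  also have "(\<lambda>y. grad_sq i (cube_ext n E) (y \<circ> h)) = grad_sq (\<sigma> i) (cube_ext n E)"
    by (simp add: fun_eq_iff grad_sq_def upd ext)
  finally show ?thesis by (simp add: cube_avg_eq_expectation[OF ab])
qed

text \<open>An invariant quantity is constant on the orbit of \<open>i\<close>, which contributes at least \<open>m\<close> equal terms
  to the sum.\<close>

lemma symmetric_influence_le:
  fixes J :: "nat \<Rightarrow> real"
  assumes sym: "has_symmetry n m E" and E: "E \<subseteq> cube n" and i: "i \<in> {1..n}"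
    and J: "\<And>j. 0 \<le> J j"
    and inv: "\<And>\<sigma> j. bij_betw \<sigma> {1..n} {1..n} \<Longrightarrow> permute_coords n \<sigma> ` E = E \<Longrightarrow> j \<in> {1..n}
      \<Longrightarrow> J (\<sigma> j) = J j"
  shows "m * J i \<le> (\<Sum>j = 1..n. J j)"
proof -
  obtain G :: "(nat \<Rightarrow> nat) monoid" and \<phi> where G: "symmetric_via G \<phi> n m E"
    using sym unfolding has_symmetry_def by blast
  then interpret group_action G "{1..n}" \<phi> by (simp add: symmetric_via_def)
  let ?O = "orbit G \<phi> i"
  have "?O \<in> orbits G {1..n} \<phi>" using i unfolding orbits_def by blast
  then have card: "m \<le> card ?O" using G by (simp add: symmetric_via_def)
  have const: "J j = J i" if jO: "j \<in> ?O" for j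
  proof -
    obtain g where g: "g \<in> carrier G" "j = \<phi> g i" using jO by (auto simp: orbit_def)
    have "bij_betw (\<phi> g) {1..n} {1..n}" using surj_prop[OF g(1)] inj_prop[OF g(1)] by (simp add: bij_betw_def)
    moreover have "permute_coords n (\<phi> g) ` E = E" using G g(1) by (simp add: symmetric_via_def)
    ultimately show ?thesis using inv i g(2) by simp
  qed
  have "\<phi> g i \<in> {1..n}" if "g \<in> carrier G" for g
    using surj_prop[OF that] i by blast
  then have sub: "?O \<subseteq> {1..n}" unfolding orbit_def by blast
  have "m * J i \<le> card ?O * J i" using card J by (intro mult_right_mono) auto
  also have "\<dots> = (\<Sum>j\<in>?O. J j)" using const by simp
  also have "\<dots> \<le> (\<Sum>j = 1..n. J j)" using sub J by (intro sum_mono2) auto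
  finally show ?thesis .
qed


lemma prob_cube_pmf_eq_cube_avg:
  assumes ab: "0 \<le> a" "0 \<le> b" "a + b \<le> 1"
  shows "measure_pmf.prob (cube_pmf n a b) E = cube_avg a b n (cube_ext n E) (\<lambda>_. undefined)"
proof -
  have "set_pmf (cube_pmf n a b) \<subseteq> PiE_dflt {1..n} undefined (set_pmf \<circ> (\<lambda>_. coord_pmf a b))"
    unfolding cube_pmf_def by (rule set_Pi_pmf_subset') simp
  then have "y \<in> cube n" if "y \<in> set_pmf (cube_pmf n a b)" for y
    using that set_coord_pmf[OF ab] by (fastforce simp: PiE_dflt_def cube_def PiE_def extensional_def)
  then have "measure_pmf.expectation (cube_pmf n a b) (cube_ext n E)
      = measure_pmf.expectation (cube_pmf n a b) (indicator E)"
    by (intro integral_cong_AE) (auto simp: AE_measure_pmf_iff cube_ext_on_cube)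
  then show ?thesis by (simp add: cube_avg_eq_expectation[OF ab])
qed

lemma ln_le_four_root: "0 < t \<Longrightarrow> ln t \<le> 4 * sqrt (sqrt t)"
  using ln_le_minus_one[of "sqrt (sqrt t)"] by (simp add: ln_sqrt)

text \<open>Apply the Falik--Samorodnitsky inequality with \<open>K = sqrt m\<close>. With \<open>T = p J\<close>, the sum of the squared
  \<open>L\<^sup>1\<close> norms is at most \<open>4 T\<^sup>2 / m\<close>, so the correction is \<open>4 T\<^sup>2 / sqrt m\<close>. If the claim failed,
  \<open>T\<close> would be at most of order \<open>V ln m\<close>, with \<open>V\<close> the variance, and the correction would be at most
  \<open>V\<close>; the main term \<open>V ln m / 2\<close> would then force the claim after all, with \<open>264 = 2 * 132\<close>.\<close>

theorem symmetric_total_influence_ge: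
  fixes a b p :: real
  assumes ab: "0 \<le> a" "a \<le> p" "0 \<le> b" "b \<le> p" and p: "0 < p" "p < 1 / exp 1"
    and inc: "increasing_event n E" and sym: "has_symmetry n m E" and m: "2 \<le> m"
  defines "x0 \<equiv> \<lambda>_::nat. undefined :: int"
  defines "F \<equiv> cube_avg a b n (cube_ext n E) x0"
  defines "J \<equiv> \<Sum>i = 1..n. cube_avg a b n (grad_sq i (cube_ext n E)) x0"
  shows "F * (1 - F) * ln m \<le> 264 * ln (1 / p) * (p * J)"
proof -
  note p_half = less_inverse_exp_one_imp_less_half[OF p(2)]
  have sum1: "a + b \<le> 1" using ab p_half by linarith
  define L where "L = ln (1 / p)"
  have L: "1 \<le> L"
    unfolding L_def using p by (rule one_le_ln_inverse)
  interpret three_point_lsi a b "132 * p * ln (1 / p)"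
    by unfold_locales
      (use ab sum1 p p_half L three_point_log_sobolev[OF ab sum1 p] in \<open>auto simp: L_def intro!: mult_nonneg_nonneg\<close>)
  let ?f = "cube_ext n E" and ?E = "\<lambda>g. cube_avg a b n g x0"
  define I where "I i = ?E (grad_sq i ?f)" for i
  have I: "0 \<le> I i" for i unfolding I_def by (intro cube_avg_nonneg grad_sq_nonneg)
  have J: "J = (\<Sum>i = 1..n. I i)" "0 \<le> J" using I by (auto simp: J_def I_def intro: sum_nonneg)
  have Em: "E \<subseteq> cube n" using inc by (simp add: increasing_event_def)
  have I_le: "m * I i \<le> J" if "i \<in> {1..n}" for i
    unfolding J(1)
    by (rule symmetric_influence_le[OF sym Em that I])
      (unfold I_def x0_def, rule grad_sq_permute_average[OF ab(1,3) sum1 Em])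
  define T where "T = p * J"
  have T: "0 \<le> T" using p J by (simp add: T_def)
  define r where "r = sqrt (real m)"
  have r: "0 < r" "r\<^sup>2 = m" "1 \<le> r" using m by (auto simp: r_def)
  have centred: "(?E (\<lambda>y. \<bar>?f y - site_avg a b i ?f y\<bar>))\<^sup>2 \<le> 4 * p\<^sup>2 * J / m * I i"
    if i: "i \<in> {1..n}" for i
  proof -
    have "?E (\<lambda>y. \<bar>?f y - site_avg a b i ?f y\<bar>) \<le> 2 * p * I i"
      unfolding I_def
      by (rule cube_avg_abs_centred_le_grad_sq[OF i ab(2,4) cube_ext_01])
        (auto intro!: cube_ext_mono[OF inc])
    then have "(?E (\<lambda>y. \<bar>?f y - site_avg a b i ?f y\<bar>))\<^sup>2 \<le> (2 * p * I i)\<^sup>2"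
      by (intro power_mono cube_avg_nonneg) auto
    also have "\<dots> = 4 * p\<^sup>2 * I i * I i" by (simp add: power2_eq_square)
    also have "\<dots> \<le> 4 * p\<^sup>2 * I i * (J / m)"
      using I_le[OF i] I[of i] m by (intro mult_left_mono) (auto simp: field_simps)
    finally show ?thesis by (simp add: mult_ac)
  qed
  have "(\<Sum>i = 1..n. (?E (\<lambda>y. \<bar>?f y - site_avg a b i ?f y\<bar>))\<^sup>2) \<le> (\<Sum>i = 1..n. 4 * p\<^sup>2 * J / m * I i)"
    by (intro sum_mono centred)
  also have "\<dots> = 4 * T\<^sup>2 / m"
    unfolding sum_distrib_left[symmetric] J(1)[symmetric] by (simp add: T_def power2_eq_square)
  finally have "r * (\<Sum>i = 1..n. (?E (\<lambda>y. \<bar>?f y - site_avg a b i ?f y\<bar>))\<^sup>2) \<le> r * (4 * T\<^sup>2 / m)"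
    using r by (intro mult_left_mono) auto
  also have "\<dots> = 4 * T\<^sup>2 / r" unfolding r(2)[symmetric] using r(1) by (simp add: power2_eq_square)
  finally have small: "r * (\<Sum>i = 1..n. (?E (\<lambda>y. \<bar>?f y - site_avg a b i ?f y\<bar>))\<^sup>2) \<le> 4 * T\<^sup>2 / r" .
  define V where "V = F * (1 - F)"
  have F: "0 \<le> F" "F \<le> 1"
    using cube_avg_nonneg[of ?f n x0] cube_avg_mono[of ?f "\<lambda>_. 1" n x0]
    by (simp_all add: F_def cube_avg_const cube_ext_def)
  then have V: "0 \<le> V" "V \<le> 1" by (auto simp: V_def mult_le_one)
  have "(\<lambda>y. (?f y)\<^sup>2) = ?f" by (rule ext) (simp add: cube_ext_def indicator_def)
  then have var: "?E (\<lambda>y. (?f y)\<^sup>2) - (?E ?f)\<^sup>2 = V"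
    by (simp add: V_def F_def power2_eq_square algebra_simps)
  have lnr: "ln r = ln m / 2" using m by (simp add: r_def ln_sqrt)
  have main: "V * (ln m / 2 + 1) - 4 * T\<^sup>2 / r \<le> 132 * L * T"
    using falik_samorodnitsky[OF r(1), of n ?f x0] small
    unfolding var lnr J_def[symmetric] L_def[symmetric] by (simp add: T_def mult_ac)
  show ?thesis
  proof (rule ccontr)
    assume "\<not> ?thesis"
    then have less: "264 * (L * T) < V * ln m" by (simp add: V_def L_def T_def)
    have "1 * T \<le> L * T" using L T by (intro mult_right_mono) auto
    moreover have "ln (real m) \<le> 4 * sqrt r" using ln_le_four_root[of m] m by (simp add: r_def)
    then have "V * ln m \<le> V * (4 * sqrt r)" using V by (intro mult_left_mono) auto
    ultimately have "66 * T \<le> V * sqrt r" using less by linarith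
    then have "(66 * T)\<^sup>2 \<le> (V * sqrt r)\<^sup>2" using T by (intro power_mono) auto
    also have "\<dots> = V * V * r" using r by (simp add: power_mult_distrib power2_eq_square)
    also have "\<dots> \<le> V * 1 * r" using V r by (intro mult_right_mono mult_left_mono) auto
    finally have "4356 * T\<^sup>2 \<le> V * r" by (simp add: power_mult_distrib)
    moreover have "0 \<le> T\<^sup>2" by simp
    ultimately have "4 * T\<^sup>2 \<le> V * r" by linarith
    then have "4 * T\<^sup>2 / r \<le> V" using r by (simp add: field_simps)
    with main less show False by (simp add: algebra_simps)
  qed
qed

section \<open>The sharp threshold\<close>

text \<open>The logit of \<open>\<eta>\<close> and that of \<open>1 - \<eta>\<close> differ by \<open>2 ln ((1 - \<eta>) / \<eta>)\<close>, which is less than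
  \<open>2 ln (1 / \<eta>)\<close>. If \<open>F\<close> did not exceed \<open>1 - \<eta>\<close> at time 1, then by monotonicity it would stay
  strictly between 0 and 1, so its logit is defined throughout.\<close>

lemma logistic_growth_crosses:
  fixes F F' :: "real \<Rightarrow> real"
  assumes \<eta>: "0 < \<eta>" "\<eta> < 1"
    and deriv: "\<And>s. 0 \<le> s \<Longrightarrow> s \<le> 1 \<Longrightarrow> (F has_real_derivative F' s) (at s)"
    and growth: "\<And>s. 0 \<le> s \<Longrightarrow> s \<le> 1 \<Longrightarrow> 2 * ln (1 / \<eta>) * (F s * (1 - F s)) \<le> F' s"
    and range: "\<And>s. 0 \<le> s \<Longrightarrow> s \<le> 1 \<Longrightarrow> 0 \<le> F s \<and> F s \<le> 1"
    and start: "\<eta> < F 0"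
  shows "1 - \<eta> < F 1"
proof (rule ccontr)
  assume "\<not> 1 - \<eta> < F 1"
  then have F1: "F 1 \<le> 1 - \<eta>" by simp
  have ln_pos: "0 < ln (1 / \<eta>)" using \<eta> by (intro ln_gt_zero) (simp add: field_simps)
  have "0 \<le> F' s" if "0 \<le> s" "s \<le> 1" for s
    using growth[OF that] range[OF that] ln_pos
    by (smt (verit) mult_nonneg_nonneg)
  then have "\<exists>y. (F has_real_derivative y) (at s) \<and> 0 \<le> y" if "0 \<le> s" "s \<le> 1" for s
    using deriv that by blast
  then have mono: "F s \<le> F t" if "0 \<le> s" "s \<le> t" "t \<le> 1" for s t
    using that by (intro DERIV_nonneg_imp_nondecreasing[of s t F]) auto
  have inside: "0 < F s" "F s < 1" if "0 \<le> s" "s \<le> 1" for s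
    using mono[of 0 s] mono[of s 1] that start F1 \<eta> by auto
  define G where "G s = ln (F s) - ln (1 - F s) - 2 * ln (1 / \<eta>) * s" for s
  have "G 0 \<le> G 1"
  proof (rule DERIV_nonneg_imp_nondecreasing[of 0 1 G])
    fix s :: real
    assume s: "0 \<le> s" "s \<le> 1"
    have "(G has_real_derivative (F' s / F s + F' s / (1 - F s) - 2 * ln (1 / \<eta>))) (at s)"
      unfolding G_def using inside[OF s]
      by (auto intro!: derivative_eq_intros deriv[OF s])
    moreover have "F' s / F s + F' s / (1 - F s) = F' s / (F s * (1 - F s))"
      using inside[OF s] by (simp add: field_simps)
    moreover have "2 * ln (1 / \<eta>) \<le> F' s / (F s * (1 - F s))"
      using growth[OF s] inside[OF s] by (simp add: pos_le_divide_eq)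
    ultimately show "\<exists>y. (G has_real_derivative y) (at s) \<and> 0 \<le> y"
      by (intro exI conjI) auto
  qed simp
  moreover have "ln \<eta> < ln (F 0)" "ln (1 - F 0) < ln (1 - \<eta>)" "ln (F 1) \<le> ln (1 - \<eta>)" "ln \<eta> \<le> ln (1 - F 1)"
    using start F1 \<eta> inside[of 0] inside[of 1] by simp_all
  moreover have "ln (1 - \<eta>) < 0" "ln (1 / \<eta>) = - ln \<eta>" using \<eta> by (auto simp: ln_div)
  ultimately show False by (simp add: G_def)
qed

text \<open>The constant \<open>528 = 2 * 264\<close> turns the influence bound into logit growth at speed \<open>2 ln (1 / \<eta>)\<close>.\<close>

theorem lemma1:
  shows "\<exists>c3::real. c3 > 0 \<and>
    (\<forall>(n::nat) (m::nat) (\<eta>::real) (pm::real) (pp::real) (qm::real) (qp::real) (E :: (nat \<Rightarrow> int) set).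
       n \<ge> 1 \<longrightarrow> m \<ge> 1 \<longrightarrow> 0 < \<eta> \<longrightarrow> \<eta> < 1 \<longrightarrow>
       0 < qm \<longrightarrow> qm < pm \<longrightarrow> pm < 1 / exp 1 \<longrightarrow>
       0 < pp \<longrightarrow> pp < qp \<longrightarrow> qp < 1 / exp 1 \<longrightarrow>
       increasing_event n E \<longrightarrow> has_symmetry n m E \<longrightarrow>
       measure_pmf.prob (cube_pmf n pm pp) E > \<eta> \<longrightarrow>
       m \<noteq> 1 \<and> min (qp - pp) (pm - qm)
         \<ge> c3 * ln (1 / \<eta>) * max qp pm * ln (1 / max qp pm) / ln (real m) \<longrightarrow>
       measure_pmf.prob (cube_pmf n qm qp) E > 1 - \<eta>)"
proof (intro exI[of _ "528::real"] conjI allI impI)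
  fix n m :: nat and \<eta> pm pp qm qp :: real and E :: "(nat \<Rightarrow> int) set"
  assume m1: "m \<ge> 1" and \<eta>: "0 < \<eta>" "\<eta> < 1"
    and minus: "0 < qm" "qm < pm" "pm < 1 / exp 1" and plus: "0 < pp" "pp < qp" "qp < 1 / exp 1"
    and inc: "increasing_event n E" and sym: "has_symmetry n m E"
    and start: "measure_pmf.prob (cube_pmf n pm pp) E > \<eta>"
    and gap: "m \<noteq> 1 \<and> min (qp - pp) (pm - qm)
         \<ge> 528 * ln (1 / \<eta>) * max qp pm * ln (1 / max qp pm) / ln (real m)"
  define p where "p = max qp pm"
  define h where "h = min (qp - pp) (pm - qm)"
  define x0 where "x0 = (\<lambda>_::nat. undefined :: int)"
  define \<alpha> where "\<alpha> s = pm + s * (qm - pm)" for s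
  define \<beta> where "\<beta> s = pp + s * (qp - pp)" for s
  let ?f = "cube_ext n E"
  define F where "F s = cube_avg (\<alpha> s) (\<beta> s) n ?f x0" for s
  define F' where "F' s = (\<Sum>i = 1..n. cube_avg (\<alpha> s) (\<beta> s) n (site_slope (qm - pm) (qp - pp) i ?f) x0)" for s
  have m: "2 \<le> m" using m1 gap by auto
  have p: "0 < p" "p < 1 / exp 1" using minus plus by (auto simp: p_def)
  note p_half = less_inverse_exp_one_imp_less_half[OF p(2)]
  have path: "0 \<le> \<alpha> s" "\<alpha> s \<le> p" "0 \<le> \<beta> s" "\<beta> s \<le> p" if s: "0 \<le> s" "s \<le> 1" for s
  proof -
    have "s * (pm - qm) \<le> 1 * (pm - qm)" "s * (qp - pp) \<le> 1 * (qp - pp)"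
      "0 \<le> s * (pm - qm)" "0 \<le> s * (qp - pp)"
      using s minus plus by (auto intro: mult_right_mono)
    then show "0 \<le> \<alpha> s" "\<alpha> s \<le> p" "0 \<le> \<beta> s" "\<beta> s \<le> p"
      using minus plus by (auto simp: \<alpha>_def \<beta>_def p_def algebra_simps)
  qed
  have tp: "three_point (\<alpha> s) (\<beta> s)" if "0 \<le> s" "s \<le> 1" for s
    using path[OF that] p_half by unfold_locales auto
  have prob: "measure_pmf.prob (cube_pmf n (\<alpha> s) (\<beta> s)) E = F s" if "0 \<le> s" "s \<le> 1" for s
    unfolding F_def x0_def using path[OF that] p_half by (intro prob_cube_pmf_eq_cube_avg) auto
  have "1 - \<eta> < F 1"
  proof (rule logistic_growth_crosses[OF \<eta>, where F' = F'])
    fix s :: real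
    assume s: "0 \<le> s" "s \<le> 1"
    interpret three_point "\<alpha> s" "\<beta> s" using tp[OF s] .
    have "(\<alpha> has_real_derivative (qm - pm)) (at s)" "(\<beta> has_real_derivative (qp - pp)) (at s)"
      unfolding \<alpha>_def \<beta>_def by (auto intro!: derivative_eq_intros)
    from cube_avg_has_derivative[OF this, of "\<lambda>_. ?f" "\<lambda>_. 0" n x0]
    show "(F has_real_derivative F' s) (at s)"
      by (simp add: F_def[abs_def] F'_def cube_avg_const)
    show "0 \<le> F s \<and> F s \<le> 1" using prob[OF s, symmetric] by simp
    define J where "J = (\<Sum>i = 1..n. cube_avg (\<alpha> s) (\<beta> s) n (grad_sq i ?f) x0)"
    have J: "0 \<le> J" unfolding J_def by (intro sum_nonneg cube_avg_nonneg grad_sq_nonneg)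
    \<comment> \<open>For an increasing indicator each difference is 0 or 1, hence equal to its square.\<close>
    have slope: "h * grad_sq i ?f y \<le> site_slope (qm - pm) (qp - pp) i ?f y" for i y
    proof -
      have vals: "?f (y(i := v)) = 0 \<or> ?f (y(i := v)) = 1" for v using cube_ext_01[of n E] by auto
      have "?f (y(i := -1)) \<le> ?f (y(i := 0))" "?f (y(i := 0)) \<le> ?f (y(i := 1))"
        by (auto intro!: cube_ext_mono[OF inc])
      then show ?thesis
        using vals[of "-1"] vals[of 0] vals[of 1] by (auto simp: grad_sq_def site_slope_def h_def)
    qed
    have "h * J = (\<Sum>i = 1..n. cube_avg (\<alpha> s) (\<beta> s) n (\<lambda>y. h * grad_sq i ?f y) x0)"
      by (simp add: J_def sum_distrib_left cube_avg_cmult)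
    also have "\<dots> \<le> F' s"
      unfolding F'_def by (intro sum_mono cube_avg_mono slope)
    finally have russo: "h * J \<le> F' s" .
    have lm: "0 < ln (real m)" using m by simp
    have l\<eta>: "0 \<le> ln (1 / \<eta>)" using \<eta> by (intro ln_ge_zero) (simp add: field_simps)
    have "F s * (1 - F s) * ln m \<le> 264 * ln (1 / p) * (p * J)"
      unfolding F_def J_def x0_def
      by (rule symmetric_total_influence_ge[OF path[OF s] p inc sym m])
    then have "F s * (1 - F s) \<le> 264 * ln (1 / p) * (p * J) / ln m"
      using lm by (simp add: pos_le_divide_eq)
    then have "2 * ln (1 / \<eta>) * (F s * (1 - F s)) \<le> 2 * ln (1 / \<eta>) * (264 * ln (1 / p) * (p * J) / ln m)"
      using l\<eta> by (intro mult_left_mono) auto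
    also have "\<dots> = (528 * ln (1 / \<eta>) * p * ln (1 / p) / ln m) * J" by simp
    also have "\<dots> \<le> h * J" using gap J by (intro mult_right_mono) (auto simp: p_def h_def)
    finally show "2 * ln (1 / \<eta>) * (F s * (1 - F s)) \<le> F' s" using russo by linarith
  next
    show "\<eta> < F 0" using start prob[of 0] by (simp add: \<alpha>_def \<beta>_def)
  qed
  then show "measure_pmf.prob (cube_pmf n qm qp) E > 1 - \<eta>"
    using prob[of 1] by (simp add: \<alpha>_def \<beta>_def)
qed simp

end
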